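(* Let $q\in\mathbb{C}$ with $0<|q|<1$. Fix $a\in\mathbb{C}$ such that $(a;q)_\infty\neq 0$, and let \[ f(z)=\sum_{n=0}^{\infty}c_nz^n \] be holomorphic in $|z|<R$, where $R>1$. Wherever the following expression is initially defined, set \[ \mathcal J_{a,f}(x):=\frac{(a/x;q)_\infty}{(q/x;q)_\infty}\int_x^1\frac{(tq/x,tq;q)_\infty}{(at/x;q)_\infty}f(t)\,d_qt . \] Then $\mathcal J_{a,f}$ extends holomorphically to $|x|<R$. More precisely, \[ \mathcal J_{a,f}(x)=\frac{(q,x;q)_\infty}{(a;q)_\infty}\sum_{k=0}^{\infty}x^k\sum_{n=0}^{\infty}\frac{(q^{k+1},a;q)_n}{(q;q)_n}\,c_{n+k}. \] The series on the right converges locally uniformly on $|x|<R$. For fixed $x$, the right-hand side also gives the meromorphic continuation in $a$, with possible poles at $a\in\{q^{-j}:j\ge 0\}$.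
   Context: For $a\in\mathbb{C}$ and $n\in\{0,1,2,\ldots\}\cup\{\infty\}$, $(a;q)_n=\prod_{j=0}^{n-1}(1-aq^j)$ and $(a_1,\ldots,a_r;q)_n=\prod_{i=1}^r(a_i;q)_n$. The Jackson $q$-integral (without the conventional factor $1-q$) is \[ \int_u^v g(t)\,d_qt:=\sum_{n=0}^{\infty}\bigl(vq^n g(vq^n)-uq^n g(uq^n)\bigr), \] whenever the series converges. *)

theory Defs
  imports "HOL-Complex_Analysis.Complex_Analysis"
begin

definition qpoch :: "complex \<Rightarrow> complex \<Rightarrow> nat \<Rightarrow> complex" where
  "qpoch a q n = (\<Prod>j<n. 1 - a * q ^ j)"

text \<open>
  The library's infinite product allows finitely many vanishing factors, in which case its value
  is 0; hence \<open>qpoch_inf a q = 0\<close> exactly when some factor vanishes (for \<open>norm q < 1\<close>).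
\<close>
definition qpoch_inf :: "complex \<Rightarrow> complex \<Rightarrow> complex" where
  "qpoch_inf a q = (\<Prod>j. 1 - a * q ^ j)"

definition jackson_term ::
    "complex \<Rightarrow> complex \<Rightarrow> complex \<Rightarrow> (complex \<Rightarrow> complex) \<Rightarrow> nat \<Rightarrow> complex" where
  "jackson_term q u v g n = v * q ^ n * g (v * q ^ n) - u * q ^ n * g (u * q ^ n)"

text \<open>Normalised without the conventional factor \<open>1 - q\<close>.\<close>
definition jackson_integral ::
    "complex \<Rightarrow> complex \<Rightarrow> complex \<Rightarrow> (complex \<Rightarrow> complex) \<Rightarrow> complex" where
  "jackson_integral q u v g = (\<Sum>n. jackson_term q u v g n)"

definition J_integrand ::
    "complex \<Rightarrow> complex \<Rightarrow> (complex \<Rightarrow> complex) \<Rightarrow> complex \<Rightarrow> complex \<Rightarrow> complex" where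
  "J_integrand q a f x t =
     qpoch_inf (t * q / x) q * qpoch_inf (t * q) q / qpoch_inf (a * t / x) q * f t"

definition J :: "complex \<Rightarrow> complex \<Rightarrow> (complex \<Rightarrow> complex) \<Rightarrow> complex \<Rightarrow> complex" where
  "J q a f x =
     qpoch_inf (a / x) q / qpoch_inf (q / x) q * jackson_integral q x 1 (J_integrand q a f x)"

text \<open>
  The points \<open>x\<close> at which every term of the expression \<open>J q a f x\<close> makes sense: all divisors,
  including those at the nodes \<open>q ^ n\<close> and \<open>x * q ^ n\<close> of the Jackson integral, are nonzero, and
  the nodes lie in the disc \<open>ball 0 R\<close> on which \<open>f\<close> is given (the nodes \<open>q ^ n\<close> do so
  automatically, as \<open>R > 1\<close>). Convergence of the Jackson integral is not built in here.
\<close>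
definition J_domain :: "complex \<Rightarrow> complex \<Rightarrow> real \<Rightarrow> complex set" where
  "J_domain q a R = {x \<in> ball 0 R. x \<noteq> 0 \<and> qpoch_inf (q / x) q \<noteq> 0 \<and>
     (\<forall>n. qpoch_inf (a * q ^ n / x) q \<noteq> 0 \<and> qpoch_inf (a * (x * q ^ n) / x) q \<noteq> 0)}"

definition inner_term :: "complex \<Rightarrow> complex \<Rightarrow> (nat \<Rightarrow> complex) \<Rightarrow> nat \<Rightarrow> nat \<Rightarrow> complex" where
  "inner_term q a c k n = qpoch (q ^ (k + 1)) q n * qpoch a q n / qpoch q q n * c (n + k)"

definition outer_term ::
    "complex \<Rightarrow> complex \<Rightarrow> (nat \<Rightarrow> complex) \<Rightarrow> complex \<Rightarrow> nat \<Rightarrow> complex" where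
  "outer_term q a c x k = x ^ k * (\<Sum>n. inner_term q a c k n)"

definition J_series :: "complex \<Rightarrow> complex \<Rightarrow> (nat \<Rightarrow> complex) \<Rightarrow> complex \<Rightarrow> complex" where
  "J_series q a c x =
     qpoch_inf q q * qpoch_inf x q / qpoch_inf a q * (\<Sum>k. outer_term q a c x k)"

definition locally_uniform_limit ::
    "complex set \<Rightarrow> (nat \<Rightarrow> complex \<Rightarrow> complex) \<Rightarrow> (complex \<Rightarrow> complex) \<Rightarrow> bool" where
  "locally_uniform_limit A F l \<longleftrightarrow>
     (\<forall>x\<in>A. \<exists>U. open U \<and> x \<in> U \<and> uniform_limit (U \<inter> A) F l sequentially)"

end

theory Submission
  imports Defs
begin

text \<open>
  Let \<open>w(t) = (tq/x, tq;q)\<^sub>\<infinity> / (at/x;q)\<^sub>\<infinity>\<close> be the weight of the Jackson integral and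
  \<open>I\<^sub>m\<close> its moments, the integrals of \<open>w(t) t\<^sup>m\<close> over \<open>[x, 1]\<close>. The functional equation
  \<open>w(t) (1 - at/x) = (1 - tq/x) (1 - tq) w(tq)\<close> shows that, for
  \<open>h(t) = x t\<^sup>m (1 - t/x) (1 - t) w(t)\<close>, the quotient \<open>(h(t) - h(tq)) / t\<close> is \<open>w(t)\<close> times a
  polynomial. Its Jackson integral telescopes to \<open>h(1) - h(x) = 0\<close>. This is the recurrence
  (\<open>moment_recurrence\<close>)
  \<open>I\<^sub>m\<^sub>+\<^sub>1 = (1 + x - a q\<^sup>m) I\<^sub>m - x (1 - q\<^sup>m) I\<^sub>m\<^sub>-\<^sub>1\<close>. By the \<open>q\<close>-Pascal rule it is solved by
  \<open>I\<^sub>m = I\<^sub>0 P\<^sub>m(x)\<close>, where \<open>P\<^sub>m(x)\<close> is the sum over \<open>k \<le> m\<close> of the \<open>q\<close>-binomial coefficient of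
  \<open>m\<close> over \<open>k\<close> times \<open>(a;q)\<^sub>m\<^sub>-\<^sub>k x\<^sup>k\<close> (\<open>moment_eq\<close>).

  The zeroth moment is found from its dependence on \<open>a\<close>. Replacing \<open>a\<close> by \<open>aq\<close> multiplies \<open>w(t)\<close>
  by \<open>1 - at/x\<close>, and the recurrence for \<open>m = 0\<close> gives
  \<open>I\<^sub>0(aq) = (1 - a) (1 - a/x) I\<^sub>0(a)\<close>. Iterating, \<open>(a, a/x;q)\<^sub>\<infinity> I\<^sub>0(a)\<close> equals \<open>I\<^sub>0(0)\<close> for every
  admissible \<open>a\<close>. For \<open>a = q\<close> the integral telescopes to \<open>(x;q)\<^sub>\<infinity>\<close>, so the common value is
  \<open>(q, x, q/x;q)\<^sub>\<infinity>\<close> (\<open>moment_0_eq\<close>). Multiplied by the prefactor \<open>(a/x;q)\<^sub>\<infinity> / (q/x;q)\<^sub>\<infinity>\<close>, the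
  zeroth moment becomes \<open>(q, x;q)\<^sub>\<infinity> / (a;q)\<^sub>\<infinity>\<close>.

  It remains to integrate \<open>f\<close> term by term and to collect the powers of \<open>x\<close>. The coefficients of
  \<open>f\<close> decay like \<open>\<rho>\<^sup>-\<^sup>n\<close> for each positive \<open>\<rho> < R\<close>, while the \<open>q\<close>-Pochhammer quotients are bounded,
  uniformly for \<open>a\<close> in a bounded set. Hence all double series are dominated by products of
  geometric series; this justifies both rearrangements (\<open>J_eq_J_series\<close>) and, through the
  Weierstrass test, yields local uniform convergence and holomorphy in \<open>x\<close> and in \<open>a\<close>. Dividing by
  the entire function \<open>(a;q)\<^sub>\<infinity>\<close>, whose zeros are the points \<open>q\<^sup>-\<^sup>j\<close>, gives the meromorphic
  continuation in \<open>a\<close>.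
\<close>

section \<open>Interchange of summations and series of holomorphic functions\<close>

text \<open>
  The order of summation may be exchanged because a product bound dominates the partial sums over
  \<open>m\<close> by \<open>A n * suminf B\<close>, independently of how many columns have been summed; Tannery's theorem
  then passes to the limit.
\<close>
lemma suminf_swap_of_product_bound:
  fixes F :: "nat \<Rightarrow> nat \<Rightarrow> complex"
  assumes bound: "\<And>n m. norm (F n m) \<le> A n * B m"
    and A: "summable A" and B: "summable B" and B_nonneg: "\<And>m. 0 \<le> B m"
  shows "(\<lambda>m. \<Sum>n. F n m) sums (\<Sum>n. \<Sum>m. F n m)"
proof -
  have col: "summable (\<lambda>n. F n m)" for m
    by (rule summable_comparison_test'[OF summable_mult2[OF A]]) (rule bound)
  have row: "summable (F n)" for n
    by (rule summable_comparison_test'[OF summable_mult[OF B]]) (rule bound)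
  \<comment> \<open>Only where \<open>B\<close> vanishes identically may \<open>A\<close> take negative values.\<close>
  have A_nonneg: "0 \<le> A n" if "B m \<noteq> 0" for n m
    using order_trans[OF norm_ge_zero bound[of n m]] that B_nonneg[of m]
    by (simp add: zero_le_mult_iff)
  have "(\<lambda>M. \<Sum>n. \<Sum>m<M. F n m) \<longlonglongrightarrow> (\<Sum>n. \<Sum>m. F n m)"
  proof (intro tannerys_theorem[THEN conjunct2, THEN conjunct2])
    show "(\<lambda>M. \<Sum>m<M. F n m) \<longlonglongrightarrow> (\<Sum>m. F n m)" for n
      using summable_LIMSEQ[OF row] .
    have "norm (\<Sum>m<M. F n m) \<le> A n * suminf B" for n M
    proof (cases "\<forall>m. B m = 0")
      case True
      then have "norm (F n m) \<le> 0" for m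
        using bound[of n m] by simp
      moreover have "B = (\<lambda>_. 0)" using True by auto
      ultimately show ?thesis by simp
    next
      case False
      then have "0 \<le> A n" using A_nonneg by blast
      have "norm (\<Sum>m<M. F n m) \<le> (\<Sum>m<M. A n * B m)"
        by (intro sum_norm_le bound)
      also have "\<dots> = A n * (\<Sum>m<M. B m)"
        by (simp add: sum_distrib_left)
      also have "\<dots> \<le> A n * suminf B"
        by (intro mult_left_mono sum_le_suminf B \<open>0 \<le> A n\<close>) (simp_all add: B_nonneg)
      finally show ?thesis .
    qed
    then show "\<forall>\<^sub>F (n, M) in sequentially \<times>\<^sub>F sequentially.
        norm (\<Sum>m<M. F n m) \<le> A n * suminf B"
      by (intro always_eventually) auto
    show "summable (\<lambda>n. A n * suminf B)"
      by (rule summable_mult2[OF A])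
  qed auto
  moreover have "(\<Sum>n. \<Sum>m<M. F n m) = (\<Sum>m<M. \<Sum>n. F n m)" for M
    by (intro suminf_sum col)
  ultimately show ?thesis
    by (simp add: sums_def)
qed

lemma holomorphic_on_suminf:
  fixes g :: "nat \<Rightarrow> complex \<Rightarrow> complex"
  assumes S: "open S" and g: "\<And>n. g n holomorphic_on S"
    and bound: "\<And>z. z \<in> S \<Longrightarrow> \<exists>d>0. cball z d \<subseteq> S \<and>
      (\<exists>M. summable M \<and> (\<forall>n. \<forall>w\<in>cball z d. norm (g n w) \<le> M n))"
  shows "(\<lambda>z. \<Sum>n. g n z) holomorphic_on S"
proof (rule holomorphic_uniform_sequence[OF S, where f = "\<lambda>N z. \<Sum>n<N. g n z"])
  show "(\<lambda>z. \<Sum>n<N. g n z) holomorphic_on S" for N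
    by (intro holomorphic_intros g)
next
  fix z assume "z \<in> S"
  then obtain d M where "d > 0" "cball z d \<subseteq> S" "summable M"
    and "\<And>n w. w \<in> cball z d \<Longrightarrow> norm (g n w) \<le> M n"
    using bound by meson
  then show "\<exists>d>0. cball z d \<subseteq> S \<and>
      uniform_limit (cball z d) (\<lambda>N z. \<Sum>n<N. g n z) (\<lambda>z. \<Sum>n. g n z) sequentially"
    by (intro exI[of _ d] conjI Weierstrass_m_test)
qed

lemma norm_cball_add: "norm (w::complex) \<le> norm z + d" if "w \<in> cball z d"
  using that norm_triangle_ineq2[of w z] by (simp add: dist_norm norm_minus_commute)

section \<open>Infinite q-Pochhammer symbols\<close>

locale q_disc =
  fixes q :: complex
  assumes norm_q: "norm q < 1"
begin

lemma qpoch_has_prod: "(\<lambda>j. 1 - a * q ^ j) has_prod qpoch_inf a q"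
proof -
  have "summable (\<lambda>j. norm a * norm q ^ j)"
    using norm_q by (intro summable_mult summable_geometric) auto
  then have "convergent_prod (\<lambda>j. 1 - a * q ^ j)"
    by (intro abs_convergent_prod_imp_convergent_prod summable_imp_abs_convergent_prod)
       (simp add: norm_mult norm_power)
  then show ?thesis
    unfolding qpoch_inf_def by (rule convergent_prod_has_prod)
qed

lemma qpoch_LIMSEQ: "(\<lambda>n. qpoch a q n) \<longlonglongrightarrow> qpoch_inf a q"
proof -
  have "(\<lambda>n. \<Prod>j\<le>n. 1 - a * q ^ j) \<longlonglongrightarrow> qpoch_inf a q"
    unfolding qpoch_inf_def
    using qpoch_has_prod convergent_prod_LIMSEQ has_prod_iff by blast
  then show ?thesis
    by (simp add: qpoch_def LIMSEQ_lessThan_iff_atMost)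
qed

lemma qpoch_Suc_shift: "qpoch a q (Suc n) = (1 - a) * qpoch (a * q) q n"
  unfolding qpoch_def by (subst prod.lessThan_Suc_shift) (simp add: mult_ac)

lemma qpoch_inf_shift: "qpoch_inf a q = (1 - a) * qpoch_inf (a * q) q"
proof -
  have "(\<lambda>n. qpoch a q (Suc n)) \<longlonglongrightarrow> (1 - a) * qpoch_inf (a * q) q"
    unfolding qpoch_Suc_shift by (intro tendsto_intros qpoch_LIMSEQ)
  then show ?thesis
    using LIMSEQ_unique LIMSEQ_Suc[OF qpoch_LIMSEQ] by blast
qed

lemma qpoch_inf_0 [simp]: "qpoch_inf 0 q = 1"
  by (simp add: qpoch_inf_def)

lemma qpoch_inf_1 [simp]: "qpoch_inf 1 q = 0"
  by (subst qpoch_inf_shift) simp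

lemma qpoch_inf_eq_0_iff: "qpoch_inf a q = 0 \<longleftrightarrow> (\<exists>j. a * q ^ j = 1)"
  using has_prod_eq_0_iff[OF qpoch_has_prod, of a] by auto

lemma qpoch_inf_power_nonzero: "qpoch_inf a q \<noteq> 0 \<Longrightarrow> qpoch_inf (a * q ^ n) q \<noteq> 0"
  by (auto simp: qpoch_inf_eq_0_iff mult.assoc simp flip: power_add)

lemma power_q_neq_1: "q ^ Suc j \<noteq> 1"
proof
  assume "q ^ Suc j = 1"
  then have "norm q ^ Suc j = 1" by (metis norm_one norm_power)
  moreover have "norm q ^ Suc j < 1"
    using norm_q by (cases "q = 0") (auto intro: power_Suc_less_one simp del: power_Suc)
  ultimately show False by simp
qed

lemma qpoch_inf_q_nonzero: "qpoch_inf q q \<noteq> 0"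
  using power_q_neq_1 by (simp add: qpoch_inf_eq_0_iff)

lemma qpoch_q_nonzero: "qpoch q q n \<noteq> 0"
  using power_q_neq_1 by (simp add: qpoch_def)

text \<open>
  The estimate uses only the modulus of \<open>a\<close>, so it is uniform in \<open>n\<close> and for \<open>a\<close> in any bounded
  set.
\<close>
lemma norm_qpoch_le: "norm (qpoch a q n) \<le> exp (norm a / (1 - norm q))"
proof -
  have "norm (qpoch a q n) \<le> (\<Prod>j<n. exp (norm a * norm q ^ j))"
    unfolding qpoch_def prod_norm[symmetric]
  proof (intro prod_mono conjI norm_ge_zero)
    fix j
    have "norm (1 - a * q ^ j) \<le> 1 + norm a * norm q ^ j"
      by (metis norm_mult norm_one norm_power norm_triangle_ineq4)
    also have "\<dots> \<le> exp (norm a * norm q ^ j)"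
      by (rule exp_ge_add_one_self)
    finally show "norm (1 - a * q ^ j) \<le> exp (norm a * norm q ^ j)" .
  qed
  also have "\<dots> = exp (norm a * (\<Sum>j<n. norm q ^ j))"
    by (simp add: exp_sum sum_distrib_left)
  also have "\<dots> \<le> exp (norm a * (1 / (1 - norm q)))"
  proof -
    have "(\<Sum>j<n. norm q ^ j) \<le> (\<Sum>j. norm q ^ j)"
      using norm_q by (intro sum_le_suminf summable_geometric) auto
    also have "\<dots> = 1 / (1 - norm q)"
      using norm_q by (intro suminf_geometric) auto
    finally show ?thesis by (simp only: exp_le_cancel_iff) (intro mult_left_mono norm_ge_zero)
  qed
  finally show ?thesis by simp
qed

lemma qpoch_inf_holomorphic: "(\<lambda>a. qpoch_inf a q) holomorphic_on UNIV"
proof (rule holomorphic_uniform_sequence[where f = "\<lambda>n a. qpoch a q n"])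
  show "(\<lambda>a. qpoch a q n) holomorphic_on UNIV" for n
    unfolding qpoch_def by (intro holomorphic_intros)
next
  fix z :: complex
  have "uniformly_convergent_on (cball z 1) (\<lambda>N a. \<Sum>j<N. norm ((1 - a * q ^ j) - 1))"
  proof (rule Weierstrass_m_test'[where M = "\<lambda>j. (norm z + 1) * norm q ^ j"])
    fix j a assume "a \<in> cball z 1"
    then have "norm a \<le> norm z + 1"
      by (rule norm_cball_add)
    then show "norm (norm ((1 - a * q ^ j) - 1)) \<le> (norm z + 1) * norm q ^ j"
      by (simp add: norm_mult norm_power mult_right_mono)
  qed (use norm_q in \<open>auto intro!: summable_mult summable_geometric\<close>)
  then have "uniformly_convergent_on (cball z 1) (\<lambda>N a. \<Prod>j<N. 1 - a * q ^ j)"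
    by (intro uniformly_convergent_on_prod') (auto intro!: continuous_intros)
  then obtain l where l: "uniform_limit (cball z 1) (\<lambda>N a. qpoch a q N) l sequentially"
    unfolding uniformly_convergent_on_def qpoch_def by blast
  have "l a = qpoch_inf a q" if "a \<in> cball z 1" for a
    using tendsto_uniform_limitI[OF l that] qpoch_LIMSEQ LIMSEQ_unique by blast
  then have "uniform_limit (cball z 1) (\<lambda>N a. qpoch a q N) (\<lambda>a. qpoch_inf a q) sequentially"
    using l by (subst uniform_limit_cong'[where g = "\<lambda>N a. qpoch a q N" and i = l]) auto
  then show "\<exists>d>0. cball z d \<subseteq> UNIV \<and>
      uniform_limit (cball z d) (\<lambda>N a. qpoch a q N) (\<lambda>a. qpoch_inf a q) sequentially"
    by (intro exI[of _ 1]) auto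
qed auto

lemma isCont_qpoch_inf: "isCont (\<lambda>a. qpoch_inf a q) a"
  using holomorphic_on_imp_continuous_on[OF qpoch_inf_holomorphic]
  by (simp add: continuous_on_eq_continuous_at)

lemma tendsto_qpoch_inf [tendsto_intros]:
  "(g \<longlongrightarrow> l) F \<Longrightarrow> ((\<lambda>z. qpoch_inf (g z) q) \<longlongrightarrow> qpoch_inf l q) F"
  by (rule isCont_tendsto_compose[OF isCont_qpoch_inf])

section \<open>Jackson integrals and the weight\<close>

lemma LIMSEQ_node: "(\<lambda>n. v * q ^ n) \<longlonglongrightarrow> 0"
  using tendsto_mult_right_zero[OF LIMSEQ_power_zero[OF norm_q]] .

text \<open>
  The fundamental theorem of \<open>q\<close>-calculus: a function with a \<open>q\<close>-antiderivative \<open>h\<close>, in the sense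
  that \<open>t g(t) = h(t) - h(tq)\<close>, has a telescoping Jackson integral. The common limit \<open>L\<close> of \<open>h\<close>
  along the two sequences of nodes cancels.
\<close>
lemma jackson_telescope:
  assumes "(\<lambda>n. h (v * q ^ n)) \<longlonglongrightarrow> L" and "(\<lambda>n. h (u * q ^ n)) \<longlonglongrightarrow> L"
    and v: "\<And>n. v * q ^ n * g (v * q ^ n) = h (v * q ^ n) - h (v * q ^ n * q)"
    and u: "\<And>n. u * q ^ n * g (u * q ^ n) = h (u * q ^ n) - h (u * q ^ n * q)"
  shows "jackson_term q u v g sums (h v - h u)"
proof -
  have "(\<lambda>n. (h (v * q ^ n) - h (v * q ^ Suc n)) - (h (u * q ^ n) - h (u * q ^ Suc n)))
      sums ((h (v * q ^ 0) - L) - (h (u * q ^ 0) - L))"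
    by (intro sums_diff telescope_sums' assms)
  then show ?thesis
    unfolding jackson_term_def[abs_def] u v by (simp add: mult_ac)
qed

lemma summable_jackson_term:
  assumes v: "(\<lambda>n. g (v * q ^ n)) \<longlonglongrightarrow> L" and u: "(\<lambda>n. g (u * q ^ n)) \<longlonglongrightarrow> L'"
  shows "summable (jackson_term q u v g)"
proof -
  have *: "summable (\<lambda>n. w * q ^ n * g (w * q ^ n))" if lim: "(\<lambda>n. g (w * q ^ n)) \<longlonglongrightarrow> l" for w l
  proof -
    obtain C where C: "\<And>n. norm (g (w * q ^ n)) \<le> C"
      using convergent_imp_Bseq[of "\<lambda>n. g (w * q ^ n)"] lim
      by (auto simp: Bseq_def convergent_def)
    show ?thesis
    proof (rule summable_comparison_test')
      show "summable (\<lambda>n. norm w * C * norm q ^ n)"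
        using norm_q by (intro summable_mult summable_geometric) auto
      show "norm (w * q ^ n * g (w * q ^ n)) \<le> norm w * C * norm q ^ n" for n
        using mult_left_mono[OF C, of "norm w * norm q ^ n" n]
        by (simp add: norm_mult norm_power mult_ac)
    qed
  qed
  show ?thesis
    unfolding jackson_term_def[abs_def] by (intro summable_diff *[OF v] *[OF u])
qed

definition beta_weight :: "complex \<Rightarrow> complex \<Rightarrow> complex \<Rightarrow> complex" where
  "beta_weight a x t =
     qpoch_inf (t * q / x) q * qpoch_inf (t * q) q / qpoch_inf (a * t / x) q"

lemma J_integrand_eq: "J_integrand q a f x t = beta_weight a x t * f t"
  by (simp add: J_integrand_def beta_weight_def)

lemma beta_weight_tendsto_1: "(\<lambda>n. beta_weight a x (v * q ^ n)) \<longlonglongrightarrow> 1"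
proof -
  have node: "(\<lambda>n. w * (v * q ^ n)) \<longlonglongrightarrow> 0" for w
    using tendsto_mult_right_zero[OF LIMSEQ_node] .
  have "beta_weight a x t =
      qpoch_inf (q / x * t) q * qpoch_inf (q * t) q / qpoch_inf (a / x * t) q" for t
    by (simp add: beta_weight_def mult_ac)
  then have "(\<lambda>n. beta_weight a x (v * q ^ n)) \<longlonglongrightarrow>
      qpoch_inf 0 q * qpoch_inf 0 q / qpoch_inf 0 q"
    by (simp only:) (intro tendsto_intros node, simp)
  then show ?thesis by simp
qed

text \<open>
  The \<open>q\<close>-Pearson equation of the weight: it turns multiplication of the weight by a quadratic
  polynomial at \<open>tq\<close> into multiplication by a linear one at \<open>t\<close>, and is the source of the
  three-term recurrence of the moments.
\<close>
lemma beta_weight_shift: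
  assumes "qpoch_inf (a * t / x) q \<noteq> 0"
  shows "beta_weight a x t * (1 - a * t / x)
       = (1 - t * q / x) * (1 - t * q) * beta_weight a x (t * q)"
proof -
  have "qpoch_inf (a * t / x) q = (1 - a * t / x) * qpoch_inf (a * (t * q) / x) q"
    by (subst qpoch_inf_shift) (simp add: mult_ac)
  moreover have "qpoch_inf (t * q / x) q = (1 - t * q / x) * qpoch_inf (t * q * q / x) q"
    by (subst qpoch_inf_shift) simp
  moreover have "qpoch_inf (t * q) q = (1 - t * q) * qpoch_inf (t * q * q) q"
    by (rule qpoch_inf_shift)
  ultimately show ?thesis
    using assms by (simp add: beta_weight_def)
qed

section \<open>Moments of the weight\<close>

definition moment :: "complex \<Rightarrow> complex \<Rightarrow> nat \<Rightarrow> complex" where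
  "moment a x m = jackson_integral q x 1 (J_integrand q a (\<lambda>t. t ^ m) x)"

lemma summable_J_integrand:
  assumes "isCont f 0"
  shows "summable (jackson_term q x 1 (J_integrand q a f x))"
proof (rule summable_jackson_term)
  have "(\<lambda>n. J_integrand q a f x (v * q ^ n)) \<longlonglongrightarrow> 1 * f 0" for v
    unfolding J_integrand_eq
    by (intro tendsto_mult beta_weight_tendsto_1 isCont_tendsto_compose[OF assms] LIMSEQ_node)
  then show "(\<lambda>n. J_integrand q a f x (1 * q ^ n)) \<longlonglongrightarrow> 1 * f 0"
    and "(\<lambda>n. J_integrand q a f x (x * q ^ n)) \<longlonglongrightarrow> 1 * f 0"
    by blast+
qed

lemma moment_sums: "jackson_term q x 1 (J_integrand q a (\<lambda>t. t ^ m) x) sums moment a x m"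
  unfolding moment_def jackson_integral_def
  by (intro summable_sums summable_J_integrand continuous_intros)

text \<open>
  The antiderivative is \<open>h(t) = x t\<^sup>m (1 - t/x) (1 - t) w(t)\<close>, where \<open>w\<close> is the weight. It vanishes
  at both end points \<open>1\<close> and \<open>x\<close>, and by the Pearson equation \<open>h(t) - h(tq)\<close> is \<open>t w(t)\<close> times a
  polynomial in \<open>t\<close>; integrating gives a linear relation between three consecutive moments.
  For \<open>m = 0\<close> the last term has coefficient \<open>0\<close>, so the truncated index \<open>m - 1\<close> is harmless.
\<close>
lemma moment_recurrence:
  assumes x: "x \<noteq> 0" and a: "qpoch_inf a q \<noteq> 0" and ax: "qpoch_inf (a / x) q \<noteq> 0"
  shows "moment a x (Suc m) =
    (1 + x - a * q ^ m) * moment a x m - x * (1 - q ^ m) * moment a x (m - 1)"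
proof -
  define w where "w = beta_weight a x"
  define h where "h t = x * t ^ m * (1 - t / x) * (1 - t) * w t" for t
  define g where "g t = w t * (x * (1 - q ^ m) * t ^ (m - 1) - (1 + x - a * q ^ m) * t ^ m
                               + t ^ Suc m)" for t
  have tg: "t * g t = h t - h (t * q)" if "qpoch_inf (a * t / x) q \<noteq> 0" for t
  proof -
    have "h (t * q) = x * q ^ m * t ^ m * ((1 - t * q / x) * (1 - t * q) * w (t * q))"
      by (simp add: h_def power_mult_distrib mult_ac)
    also have "\<dots> = x * q ^ m * t ^ m * (w t * (1 - a * t / x))"
      using beta_weight_shift[OF that] by (simp add: w_def)
    also have "\<dots> = q ^ m * t ^ m * w t * (x - a * t)"
      using x by (simp add: field_simps)
    finally have 1: "h (t * q) = q ^ m * t ^ m * w t * (x - a * t)" .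
    have 2: "h t = t ^ m * w t * (x - t) * (1 - t)"
      using x by (simp add: h_def field_simps)
    have 3: "t * ((1 - q ^ m) * t ^ (m - 1)) = (1 - q ^ m) * t ^ m"
      by (cases m) auto
    have "t * g t = w t * (x * (t * ((1 - q ^ m) * t ^ (m - 1)))
                    - (1 + x - a * q ^ m) * t ^ m * t + t * t ^ m * t)"
      by (simp add: g_def algebra_simps)
    then show ?thesis
      unfolding 1 2 3 by (simp add: algebra_simps)
  qed
  have node_1: "qpoch_inf (a * (1 * q ^ n) / x) q \<noteq> 0" for n
    using qpoch_inf_power_nonzero[OF ax, of n] by simp
  have node_x: "qpoch_inf (a * (x * q ^ n) / x) q \<noteq> 0" for n
    using qpoch_inf_power_nonzero[OF a, of n] x by simp
  have "(\<lambda>n. h (v * q ^ n)) \<longlonglongrightarrow> x * 0 ^ m * (1 - 0 / x) * (1 - 0) * 1" for v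
    unfolding h_def w_def by (intro tendsto_intros LIMSEQ_node beta_weight_tendsto_1 x)
  then have "jackson_term q x 1 g sums (h 1 - h x)"
    by (intro jackson_telescope[where L = "x * 0 ^ m * (1 - 0 / x) * (1 - 0) * 1"]
        tg node_1 node_x)
  moreover have "h 1 = 0" "h x = 0"
    using x by (auto simp: h_def)
  ultimately have "jackson_term q x 1 g sums 0"
    by simp
  moreover have "jackson_term q x 1 g sums
      (x * (1 - q ^ m) * moment a x (m - 1) - (1 + x - a * q ^ m) * moment a x m
      + moment a x (Suc m))"
  proof -
    have "jackson_term q x 1 g = (\<lambda>n.
        x * (1 - q ^ m) * jackson_term q x 1 (J_integrand q a (\<lambda>t. t ^ (m - 1)) x) n
        - (1 + x - a * q ^ m) * jackson_term q x 1 (J_integrand q a (\<lambda>t. t ^ m) x) n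
        + jackson_term q x 1 (J_integrand q a (\<lambda>t. t ^ Suc m) x) n)"
      by (rule ext) (simp add: jackson_term_def J_integrand_eq g_def w_def algebra_simps)
    then show ?thesis
      by (simp only:) (intro sums_add sums_diff sums_mult moment_sums)
  qed
  ultimately have "0 = x * (1 - q ^ m) * moment a x (m - 1)
      - (1 + x - a * q ^ m) * moment a x m + moment a x (Suc m)"
    by (rule sums_unique2)
  moreover have "C = B - A" if "0 = A - B + C" for A B C :: complex
    using that by algebra
  ultimately show ?thesis
    by blast
qed

text \<open>
  Replacing \<open>a\<close> by \<open>aq\<close> multiplies the weight by \<open>1 - at/x\<close>, so the new zeroth moment is a
  combination of the old zeroth and first ones; the first is a multiple of the zeroth by
  the recurrence, and the resulting factor happens to split.
\<close>
lemma moment_0_shift: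
  assumes x: "x \<noteq> 0" and a: "qpoch_inf a q \<noteq> 0" and ax: "qpoch_inf (a / x) q \<noteq> 0"
  shows "moment (a * q) x 0 = (1 - a) * (1 - a / x) * moment a x 0"
proof -
  have w: "beta_weight (a * q) x t = (1 - a * t / x) * beta_weight a x t"
    if "qpoch_inf (a * t / x) q \<noteq> 0" for t
  proof -
    define d where "d = 1 - a * t / x"
    have "qpoch_inf (a * t / x) q = d * qpoch_inf (a * q * t / x) q"
      unfolding d_def by (subst qpoch_inf_shift) (simp add: mult_ac)
    then show ?thesis
      using that unfolding beta_weight_def d_def[symmetric] by simp
  qed
  have node_1: "qpoch_inf (a * (1 * q ^ n) / x) q \<noteq> 0" for n
    using qpoch_inf_power_nonzero[OF ax, of n] by simp
  have node_x: "qpoch_inf (a * (x * q ^ n) / x) q \<noteq> 0" for n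
    using qpoch_inf_power_nonzero[OF a, of n] x by simp
  have "jackson_term q x 1 (J_integrand q (a * q) (\<lambda>t. t ^ 0) x) =
      (\<lambda>n. jackson_term q x 1 (J_integrand q a (\<lambda>t. t ^ 0) x) n
      - a / x * jackson_term q x 1 (J_integrand q a (\<lambda>t. t ^ Suc 0) x) n)"
    unfolding jackson_term_def J_integrand_eq w[OF node_1] w[OF node_x]
    by (rule ext) (simp add: algebra_simps)
  then have "jackson_term q x 1 (J_integrand q (a * q) (\<lambda>t. t ^ 0) x) sums
      (moment a x 0 - a / x * moment a x (Suc 0))"
    by (simp only:) (intro sums_diff sums_mult moment_sums)
  then have "moment (a * q) x 0 = moment a x 0 - a / x * moment a x (Suc 0)"
    using moment_sums sums_unique2 by blast
  also have "\<dots> = (1 - a) * (1 - a / x) * moment a x 0"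
  proof -
    have "moment a x (Suc 0) = (1 + x - a) * moment a x 0"
      using moment_recurrence[OF x a ax, of 0] by simp
    moreover have "M - a / x * ((1 + x - a) * M) = (1 - a) * (1 - a / x) * M" for M
      using x by (simp add: field_simps)
    ultimately show ?thesis by simp
  qed
  finally show ?thesis .
qed

lemma moment_0_iterate:
  assumes x: "x \<noteq> 0" and a: "qpoch_inf a q \<noteq> 0" and ax: "qpoch_inf (a / x) q \<noteq> 0"
  shows "moment (a * q ^ n) x 0 = qpoch a q n * qpoch (a / x) q n * moment a x 0"
proof (induction n)
  case (Suc n)
  have "qpoch_inf (a * q ^ n / x) q \<noteq> 0"
    using qpoch_inf_power_nonzero[OF ax, of n] by simp
  note shift = moment_0_shift[OF x qpoch_inf_power_nonzero[OF a] this]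
  have "moment (a * q ^ Suc n) x 0 = moment (a * q ^ n * q) x 0"
    by (simp add: mult_ac)
  also have "\<dots> = (1 - a * q ^ n) * (1 - a * q ^ n / x) *
      (qpoch a q n * qpoch (a / x) q n * moment a x 0)"
    unfolding shift Suc.IH ..
  also have "\<dots> = qpoch a q (Suc n) * qpoch (a / x) q (Suc n) * moment a x 0"
    by (simp add: qpoch_def)
  finally show ?case .
qed (simp add: qpoch_def)

text \<open>
  The node \<open>v q\<^sup>k\<close> and the parameter \<open>a q\<^sup>n\<close> enter the denominator of the weight only through
  \<open>n + k\<close>. Hence the weights are bounded uniformly in \<open>n\<close> and \<open>k\<close>, and the factor \<open>q\<^sup>k\<close> of the
  Jackson integral provides the majorant for Tannery's theorem.
\<close>
lemma moment_0_tendsto: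
  assumes x: "x \<noteq> 0" and a: "qpoch_inf a q \<noteq> 0" and ax: "qpoch_inf (a / x) q \<noteq> 0"
  shows "(\<lambda>n. moment (a * q ^ n) x 0) \<longlonglongrightarrow> moment 0 x 0"
proof -
  have node: "(\<lambda>n. w * q ^ (n + k)) \<longlonglongrightarrow> 0" for w k
    using LIMSEQ_ignore_initial_segment[OF LIMSEQ_node] .
  have shifted: "beta_weight (a * q ^ n) x (v * q ^ k) =
      beta_weight 0 x (v * q ^ k) / qpoch_inf (a * v / x * q ^ (n + k)) q" for n k v
    by (simp add: beta_weight_def power_add mult_ac)
  have bound: "\<exists>C. \<forall>n k. norm (beta_weight (a * q ^ n) x (v * q ^ k)) \<le> C" for v
  proof -
    have "(\<lambda>j. 1 / qpoch_inf (a * v / x * q ^ j) q) \<longlonglongrightarrow> 1 / qpoch_inf 0 q"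
      by (intro tendsto_intros LIMSEQ_node) auto
    then have "Bseq (\<lambda>j. 1 / qpoch_inf (a * v / x * q ^ j) q)"
      by (intro convergent_imp_Bseq) (auto simp: convergent_def)
    then obtain D where D: "\<And>j. norm (1 / qpoch_inf (a * v / x * q ^ j) q) \<le> D"
      unfolding Bseq_def by blast
    have "Bseq (\<lambda>k. beta_weight 0 x (v * q ^ k))"
      using beta_weight_tendsto_1 by (intro convergent_imp_Bseq) (auto simp: convergent_def)
    then obtain N where N: "\<And>k. norm (beta_weight 0 x (v * q ^ k)) \<le> N"
      unfolding Bseq_def by blast
    have "norm (beta_weight (a * q ^ n) x (v * q ^ k)) \<le> N * D" for n k
      using mult_mono[OF N[of k] D[of "n + k"] order_trans[OF norm_ge_zero N]]
      by (simp add: shifted norm_divide)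
    then show ?thesis by blast
  qed
  obtain C1 where C1: "\<And>n k. norm (beta_weight (a * q ^ n) x (1 * q ^ k)) \<le> C1"
    using bound by blast
  obtain Cx where Cx: "\<And>n k. norm (beta_weight (a * q ^ n) x (x * q ^ k)) \<le> Cx"
    using bound by blast
  define T where "T a' k = jackson_term q x 1 (J_integrand q a' (\<lambda>t. t ^ 0) x) k" for a' k
  have T: "T a' k = q ^ k * beta_weight a' x (1 * q ^ k)
      - x * q ^ k * beta_weight a' x (x * q ^ k)" for a' k
    by (simp add: T_def jackson_term_def J_integrand_eq)
  have "(\<lambda>n. \<Sum>k. T (a * q ^ n) k) \<longlonglongrightarrow> (\<Sum>k. T 0 k)"
  proof (intro tannerys_theorem[THEN conjunct2, THEN conjunct2])
    show "(\<lambda>n. T (a * q ^ n) k) \<longlonglongrightarrow> T 0 k" for k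
    proof -
      have "(\<lambda>n. beta_weight (a * q ^ n) x (v * q ^ k)) \<longlonglongrightarrow>
          beta_weight 0 x (v * q ^ k) / qpoch_inf 0 q" for v
        unfolding shifted by (intro tendsto_intros node) simp
      then have "(\<lambda>n. beta_weight (a * q ^ n) x (v * q ^ k)) \<longlonglongrightarrow>
          beta_weight 0 x (v * q ^ k)" for v
        by simp
      then show ?thesis
        unfolding T by (intro tendsto_diff tendsto_mult tendsto_const)
    qed
    have "norm (T (a * q ^ n) k) \<le> (C1 + norm x * Cx) * norm q ^ k" for n k
    proof -
      have "norm (T (a * q ^ n) k) \<le> norm (q ^ k * beta_weight (a * q ^ n) x (1 * q ^ k))
          + norm (x * q ^ k * beta_weight (a * q ^ n) x (x * q ^ k))"
        unfolding T by (rule norm_triangle_ineq4)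
      also have "\<dots> \<le> norm q ^ k * C1 + norm x * norm q ^ k * Cx"
        unfolding norm_mult norm_power using C1 Cx by (intro add_mono mult_left_mono) auto
      finally show ?thesis by (simp add: algebra_simps)
    qed
    then show "\<forall>\<^sub>F (k, n) in sequentially \<times>\<^sub>F sequentially.
        norm (T (a * q ^ n) k) \<le> (C1 + norm x * Cx) * norm q ^ k"
      by (intro always_eventually) auto
    show "summable (\<lambda>k. (C1 + norm x * Cx) * norm q ^ k)"
      using norm_q by (intro summable_mult summable_geometric) auto
  qed auto
  then show ?thesis
    by (simp add: moment_def jackson_integral_def T_def)
qed

text \<open>
  Iterating the shift \<open>a \<mapsto> aq\<close> to the limit shows that this product does not depend on \<open>a\<close>.
\<close>
lemma moment_0_times:
  assumes "x \<noteq> 0" and "qpoch_inf a q \<noteq> 0" and "qpoch_inf (a / x) q \<noteq> 0"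
  shows "qpoch_inf a q * qpoch_inf (a / x) q * moment a x 0 = moment 0 x 0"
proof (rule LIMSEQ_unique)
  show "(\<lambda>n. moment (a * q ^ n) x 0) \<longlonglongrightarrow> qpoch_inf a q * qpoch_inf (a / x) q * moment a x 0"
    unfolding moment_0_iterate[OF assms] by (intro tendsto_intros qpoch_LIMSEQ)
qed (rule moment_0_tendsto[OF assms])

text \<open>
  For \<open>a = q\<close> the weight collapses to \<open>(tq;q)\<^sub>\<infinity>\<close>, whose \<open>q\<close>-antiderivative is \<open>- (t;q)\<^sub>\<infinity>\<close>.
\<close>
lemma moment_0_at_q:
  assumes x: "x \<noteq> 0" and qx: "qpoch_inf (q / x) q \<noteq> 0"
  shows "moment q x 0 = qpoch_inf x q"
proof -
  have w: "beta_weight q x t = qpoch_inf (t * q) q" if "qpoch_inf (q * t / x) q \<noteq> 0" for t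
    using that by (simp add: beta_weight_def mult_ac)
  have node_1: "qpoch_inf (q * (1 * q ^ n) / x) q \<noteq> 0" for n
    using qpoch_inf_power_nonzero[OF qx, of n] by simp
  have node_x: "qpoch_inf (q * (x * q ^ n) / x) q \<noteq> 0" for n
    using qpoch_inf_power_nonzero[OF qpoch_inf_q_nonzero, of n] x by simp
  have lim: "(\<lambda>n. - qpoch_inf (v * q ^ n) q) \<longlonglongrightarrow> - qpoch_inf 0 q" for v
    by (intro tendsto_intros LIMSEQ_node)
  have tel: "t * qpoch_inf (t * q) q = - qpoch_inf t q - - qpoch_inf (t * q) q" for t
    by (subst (2) qpoch_inf_shift) (simp add: algebra_simps)
  have "jackson_term q x 1 (J_integrand q q (\<lambda>t. t ^ 0) x) sums
      (- qpoch_inf 1 q - - qpoch_inf x q)"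
    by (rule jackson_telescope[OF lim lim])
       (simp_all only: J_integrand_eq w[OF node_1] w[OF node_x] power_0 mult_1_right tel)
  then have "moment q x 0 = - qpoch_inf 1 q - - qpoch_inf x q"
    using moment_sums sums_unique2 by blast
  then show ?thesis by simp
qed

text \<open>
  A \<open>q\<close>-beta integral, the case of the Andrews-Askey integral in which one denominator parameter is
  zero. The left-hand side is independent of \<open>a\<close>, so it may be evaluated at \<open>a = q\<close>.
\<close>
lemma moment_0_eq:
  assumes x: "x \<noteq> 0" and qx: "qpoch_inf (q / x) q \<noteq> 0"
    and a: "qpoch_inf a q \<noteq> 0" and ax: "qpoch_inf (a / x) q \<noteq> 0"
  shows "qpoch_inf a q * qpoch_inf (a / x) q * moment a x 0
       = qpoch_inf q q * qpoch_inf x q * qpoch_inf (q / x) q"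
  using moment_0_times[OF x a ax] moment_0_times[OF x qpoch_inf_q_nonzero qx]
    moment_0_at_q[OF x qx] by (simp add: mult_ac)

section \<open>Closed form of the moments\<close>

text \<open>
  By the identity \<open>moment_coeff_eq\<close> below this is the \<open>q\<close>-binomial coefficient of \<open>n + k\<close> over \<open>k\<close>,
  times \<open>(a;q)\<^sub>n\<close>.
\<close>
definition moment_coeff :: "complex \<Rightarrow> nat \<Rightarrow> nat \<Rightarrow> complex" where
  "moment_coeff a k n = qpoch (q ^ (k + 1)) q n * qpoch a q n / qpoch q q n"

lemma inner_term_eq: "inner_term q a c k n = moment_coeff a k n * c (n + k)"
  by (simp add: inner_term_def moment_coeff_def)

lemma qpoch_q_add: "qpoch q q (n + k) = qpoch q q k * qpoch (q ^ (k + 1)) q n"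
  by (induction n) (simp_all add: qpoch_def power_add mult_ac)

lemma moment_coeff_eq:
  "moment_coeff a k n = qpoch q q (n + k) * qpoch a q n / (qpoch q q k * qpoch q q n)"
  using qpoch_q_nonzero[of k] by (simp add: moment_coeff_def qpoch_q_add)

lemma moment_coeff_n_0 [simp]: "moment_coeff a k 0 = 1"
  by (simp add: moment_coeff_def qpoch_def)

lemma moment_coeff_0_n: "moment_coeff a 0 n = qpoch a q n"
  using qpoch_q_nonzero[of n] by (simp add: moment_coeff_def)

lemma qpoch_Suc: "qpoch a q (Suc n) = qpoch a q n * (1 - a * q ^ n)"
  by (simp add: qpoch_def)

text \<open>
  With \<open>y = q\<^sup>k\<^sup>+\<^sup>1\<close> and \<open>p = q\<^sup>n\<close>, dividing out the common factor leaves an identity between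
  rational functions of \<open>y\<close>, \<open>p\<close>, \<open>q\<close>, \<open>a\<close> (\<open>key\<close> in the proof); it is a form of the
  \<open>q\<close>-Pascal rule.
\<close>
lemma moment_coeff_recurrence:
  "moment_coeff a (Suc k) (Suc n) =
     (1 - a * q ^ (n + k + 1)) * moment_coeff a (Suc k) n + moment_coeff a k (Suc n)
     - (1 - q ^ (n + k + 1)) * moment_coeff a k n"
proof -
  define y p where "y = q ^ Suc k" and "p = q ^ n"
  define U V Q A where "U = qpoch q q k" and "V = qpoch q q n"
    and "Q = qpoch q q (n + k)" and "A = qpoch a q n"
  \<comment> \<open>In terms of these, \<open>q ^ (n + k + 1) = y * p\<close> and \<open>q ^ (n + k + 2) = y * (q * p)\<close>.\<close>
  have nz: "U \<noteq> 0" "V \<noteq> 0" "1 - y \<noteq> 0" "1 - q * p \<noteq> 0"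
    using qpoch_q_nonzero power_q_neq_1[of k] power_q_neq_1[of n]
    by (auto simp: U_def V_def y_def p_def)
  have eqs: "qpoch q q (Suc k) = U * (1 - y)" "qpoch q q (Suc n) = V * (1 - q * p)"
    "qpoch q q (n + Suc k) = Q * (1 - y * p)" "qpoch q q (Suc n + k) = Q * (1 - y * p)"
    "qpoch q q (Suc n + Suc k) = Q * (1 - y * p) * (1 - y * (q * p))"
    "qpoch a q (Suc n) = A * (1 - a * p)" "q ^ (n + k + 1) = y * p"
    by (simp_all add: qpoch_Suc U_def V_def Q_def A_def y_def p_def power_add mult_ac)
  define d e where "d = 1 - y" and "e = 1 - q * p"
  have "(1 - y * (q * p)) * (1 - a * p) = (1 - a * (y * p)) * e + (1 - a * p) * d - d * e"
    by (simp add: d_def e_def algebra_simps)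
  then have key: "(1 - y * (q * p)) * (1 - a * p) / (d * e)
      = (1 - a * (y * p)) / d + (1 - a * p) / e - 1"
    using nz(3,4) unfolding d_def[symmetric] e_def[symmetric]
    by (simp add: divide_simps)
  have "Q * (1 - y * p) * (1 - y * (q * p)) * (A * (1 - a * p)) / (U * d * (V * e))
      = Q * (1 - y * p) * A / (U * V) * ((1 - y * (q * p)) * (1 - a * p) / (d * e))"
    by (simp add: mult_ac)
  also have "\<dots> = Q * (1 - y * p) * A / (U * V)
      * ((1 - a * (y * p)) / d + (1 - a * p) / e - 1)"
    unfolding key ..
  also have "\<dots> = (1 - a * (y * p)) * (Q * (1 - y * p) * A / (U * d * V))
      + Q * (1 - y * p) * (A * (1 - a * p)) / (U * (V * e)) - (1 - y * p) * (Q * A / (U * V))"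
    by (simp add: divide_inverse algebra_simps)
  finally show ?thesis
    unfolding moment_coeff_eq eqs d_def e_def
    unfolding U_def[symmetric] V_def[symmetric] Q_def[symmetric] A_def[symmetric] .
qed

text \<open>
  Ratios of moments as polynomials in \<open>x\<close>: as polynomials, they can be shown to satisfy the
  moment recurrence by comparing coefficients.
\<close>
definition moment_poly :: "complex \<Rightarrow> nat \<Rightarrow> complex poly" where
  "moment_poly a m = (\<Sum>k\<le>m. monom (moment_coeff a k (m - k)) k)"

lemma coeff_moment_poly:
  "coeff (moment_poly a m) k = (if k \<le> m then moment_coeff a k (m - k) else 0)"
  by (simp add: moment_poly_def coeff_sum)

lemma poly_moment_poly:
  "poly (moment_poly a m) x = (\<Sum>k\<le>m. moment_coeff a k (m - k) * x ^ k)"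
  by (simp add: moment_poly_def poly_sum poly_monom)

lemma moment_poly_recurrence:
  "moment_poly a (Suc m) = smult (1 - a * q ^ m) (moment_poly a m)
     + pCons 0 (moment_poly a m) - smult (1 - q ^ m) (pCons 0 (moment_poly a (m - 1)))"
proof (rule poly_eqI)
  fix k
  show "coeff (moment_poly a (Suc m)) k = coeff (smult (1 - a * q ^ m) (moment_poly a m)
     + pCons 0 (moment_poly a m) - smult (1 - q ^ m) (pCons 0 (moment_poly a (m - 1)))) k"
  proof (cases k)
    case 0
    then show ?thesis
      by (simp add: coeff_moment_poly moment_coeff_0_n qpoch_Suc)
  next
    case (Suc j)
    consider "m < j" | "j = m" | "j < m" by linarith
    then show ?thesis
    proof cases
      case 3
      define n where "n = m - Suc j"
      then have n: "m = n + j + 1"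
        using 3 by simp
      have "coeff (moment_poly a (Suc m)) k = moment_coeff a (Suc j) (Suc n)"
        by (simp add: coeff_moment_poly Suc n)
      moreover have "coeff (moment_poly a m) k = moment_coeff a (Suc j) n"
        by (simp add: coeff_moment_poly Suc n)
      moreover have "coeff (moment_poly a m) j = moment_coeff a j (Suc n)"
        by (simp add: coeff_moment_poly n)
      moreover have "coeff (moment_poly a (m - 1)) j = moment_coeff a j n"
        by (simp add: coeff_moment_poly n)
      ultimately show ?thesis
        unfolding coeff_diff coeff_add coeff_smult Suc coeff_pCons_Suc
        using moment_coeff_recurrence[of a j n] by (simp only: n)
    qed (cases m; auto simp: coeff_moment_poly Suc)+
  qed
qed

text \<open>
  Both sides satisfy the same three-term recurrence and agree for \<open>m = 0\<close>.
\<close>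
lemma moment_eq:
  assumes x: "x \<noteq> 0" and a: "qpoch_inf a q \<noteq> 0" and ax: "qpoch_inf (a / x) q \<noteq> 0"
  shows "moment a x m = moment a x 0 * poly (moment_poly a m) x"
proof (induction m rule: less_induct)
  case (less m)
  show ?case
  proof (cases m)
    case 0
    then show ?thesis by (simp add: poly_moment_poly)
  next
    case (Suc l)
    have l: "moment a x l = moment a x 0 * poly (moment_poly a l) x"
      and l': "moment a x (l - 1) = moment a x 0 * poly (moment_poly a (l - 1)) x"
      by (rule less.IH, simp add: Suc)+
    have ring: "(1 + x - b) * (M * P) - x * r * (M * P') =
        M * ((1 - b) * P + (0 + x * P) - r * (0 + x * P'))" for b r M P P'
      by (simp add: algebra_simps)
    show ?thesis
      unfolding Suc moment_recurrence[OF x a ax, of l] moment_poly_recurrence[of a l] l l'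
      unfolding poly_add poly_diff poly_smult poly_pCons by (rule ring)
  qed
qed

text \<open>
  The numerators are bounded by \<open>norm_qpoch_le\<close>, and the denominators \<open>(q;q)\<^sub>n\<close> stay away from zero
  because neither they nor their limit \<open>(q;q)\<^sub>\<infinity>\<close> vanish.
\<close>
lemma moment_coeff_bounded: "\<exists>K. \<forall>a k n. norm a \<le> A \<longrightarrow> norm (moment_coeff a k n) \<le> K"
proof -
  have "(\<lambda>n. 1 / qpoch q q n) \<longlonglongrightarrow> 1 / qpoch_inf q q"
    by (intro tendsto_intros qpoch_LIMSEQ qpoch_inf_q_nonzero)
  then have "Bseq (\<lambda>n. 1 / qpoch q q n)"
    by (intro convergent_imp_Bseq) (auto simp: convergent_def)
  then obtain D where D: "\<And>n. norm (1 / qpoch q q n) \<le> D"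
    unfolding Bseq_def by blast
  define E where "E B = exp (B / (1 - norm q))" for B :: real
  have E: "norm (qpoch b q n) \<le> E B" if "norm b \<le> B" for b B n
  proof -
    have "norm b / (1 - norm q) \<le> B / (1 - norm q)"
      using that norm_q by (intro divide_right_mono) auto
    then show ?thesis
      unfolding E_def by (intro order_trans[OF norm_qpoch_le]) simp
  qed
  have "norm (moment_coeff a k n) \<le> E 1 * E A * D" if "norm a \<le> A" for a k n
  proof -
    have "norm (q ^ (k + 1)) \<le> 1"
      unfolding norm_power using norm_q by (intro power_le_one) auto
    then have "norm (qpoch (q ^ (k + 1)) q n * qpoch a q n * (1 / qpoch q q n)) \<le> E 1 * E A * D"
      unfolding norm_mult using that
      by (intro mult_mono E D mult_nonneg_nonneg norm_ge_zero) (auto simp: E_def)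
    then show ?thesis
      by (simp add: moment_coeff_def)
  qed
  then show ?thesis by blast
qed

end

section \<open>Bounds for the double series\<close>

locale q_disc_power_series = q_disc +
  fixes R :: real and f :: "complex \<Rightarrow> complex" and c :: "nat \<Rightarrow> complex"
  assumes R_gt_1: "R > 1"
    and f_sums: "\<And>z. z \<in> ball 0 R \<Longrightarrow> (\<lambda>n. c n * z ^ n) sums f z"
    and f_holomorphic: "f holomorphic_on ball 0 R"
begin

lemma coeff_decay:
  assumes "0 < \<rho>" "\<rho> < R"
  shows "\<exists>M. 0 \<le> M \<and> (\<forall>n. norm (c n) \<le> M * (1 / \<rho>) ^ n)"
proof -
  have "summable (\<lambda>n. c n * of_real \<rho> ^ n)"
    using f_sums[of "of_real \<rho>"] assms by (auto simp: sums_iff)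
  then have "Bseq (\<lambda>n. c n * of_real \<rho> ^ n)"
    by (intro convergent_imp_Bseq summable_LIMSEQ_zero[THEN convergentI])
  then obtain M where "M > 0" and M: "\<And>n. norm (c n * of_real \<rho> ^ n) \<le> M"
    unfolding Bseq_def by blast
  have "norm (c n) \<le> M * (1 / \<rho>) ^ n" for n
    using M[of n] assms(1) by (simp add: norm_mult norm_power power_one_over field_simps)
  then show ?thesis
    using \<open>M > 0\<close> by (intro exI[of _ M]) auto
qed

lemma inner_term_bound:
  assumes "0 < \<rho>" "\<rho> < R"
  shows "\<exists>K\<ge>0. \<forall>a k n. norm a \<le> A \<longrightarrow>
    norm (inner_term q a c k n) \<le> K * (1 / \<rho>) ^ k * (1 / \<rho>) ^ n"
proof -
  obtain M where M: "0 \<le> M" "\<And>n. norm (c n) \<le> M * (1 / \<rho>) ^ n"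
    using coeff_decay[OF assms] by blast
  obtain K where K: "\<And>a k n. norm a \<le> A \<Longrightarrow> norm (moment_coeff a k n) \<le> K"
    using moment_coeff_bounded[of A] by auto
  have "norm (inner_term q a c k n) \<le> max 0 K * M * (1 / \<rho>) ^ k * (1 / \<rho>) ^ n"
    if "norm a \<le> A" for a k n
  proof -
    have "norm (inner_term q a c k n) \<le> max 0 K * (M * (1 / \<rho>) ^ (n + k))"
      unfolding inner_term_eq norm_mult
      using K[OF that, of k n] by (intro mult_mono M) auto
    then show ?thesis
      by (simp only: power_add mult_ac)
  qed
  then show ?thesis
    using M(1) by (intro exI[of _ "max 0 K * M"]) auto
qed

lemma summable_inverse_power:
  assumes "\<rho> > (1::real)"
  shows "summable (\<lambda>n. (1 / \<rho>) ^ n)"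
  using assms by (auto intro!: summable_geometric)

lemma summable_inner_term: "summable (inner_term q a c k)"
proof -
  obtain \<rho> where \<rho>: "1 < \<rho>" "\<rho> < R"
    using dense[OF R_gt_1] by blast
  then obtain K where K: "\<And>k n.
      norm (inner_term q a c k n) \<le> K * (1 / \<rho>) ^ k * (1 / \<rho>) ^ n"
    using inner_term_bound[of \<rho> "norm a"] by force
  show ?thesis
    by (rule summable_comparison_test'[OF summable_mult[OF summable_inverse_power[OF \<rho>(1)]] K])
qed

lemma outer_term_bound:
  assumes "1 < \<rho>" "\<rho> < R"
  shows "\<exists>K\<ge>0. \<forall>a x k. norm a \<le> A \<longrightarrow>
    norm (outer_term q a c x k) \<le> K * (norm x / \<rho>) ^ k"
proof -
  obtain K where "K \<ge> 0" and K: "\<And>a k n. norm a \<le> A \<Longrightarrow>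
      norm (inner_term q a c k n) \<le> K * (1 / \<rho>) ^ k * (1 / \<rho>) ^ n"
    using inner_term_bound[of \<rho> A] assms by force
  define S where "S = (\<Sum>n. (1 / \<rho>) ^ n)"
  have "S \<ge> 0"
    unfolding S_def using assms by (intro suminf_nonneg summable_inverse_power) auto
  have "norm (outer_term q a c x k) \<le> K * S * (norm x / \<rho>) ^ k" if a: "norm a \<le> A" for a x k
  proof -
    have "norm (\<Sum>n. inner_term q a c k n) \<le> (\<Sum>n. K * (1 / \<rho>) ^ k * (1 / \<rho>) ^ n)"
      by (intro norm_suminf_le K[OF a] summable_mult summable_inverse_power assms)
    also have "\<dots> = K * (1 / \<rho>) ^ k * S"
      unfolding S_def by (intro suminf_mult summable_inverse_power assms)
    finally have "norm (outer_term q a c x k) \<le> norm x ^ k * (K * (1 / \<rho>) ^ k * S)"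
      unfolding outer_term_def norm_mult norm_power by (intro mult_left_mono) auto
    then show ?thesis
      by (simp add: power_divide mult_ac)
  qed
  then show ?thesis
    using \<open>K \<ge> 0\<close> \<open>S \<ge> 0\<close> by (intro exI[of _ "K * S"]) auto
qed

lemma radius_between:
  assumes "x \<in> ball 0 R"
  obtains r \<rho> where "norm x < r" "1 < r" "r < \<rho>" "\<rho> < R"
proof -
  obtain r where r: "max 1 (norm x) < r" "r < R"
    using dense[of "max 1 (norm x)" R] assms R_gt_1 by auto
  obtain \<rho> where "r < \<rho>" "\<rho> < R"
    using dense[OF r(2)] by blast
  with r that show ?thesis by auto
qed

text \<open>
  The majorant is uniform in \<open>a\<close> and in the point \<open>w\<close>, so it serves for local uniform convergence
  and for holomorphy in either variable.
\<close>
lemma outer_term_majorant: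
  assumes "x \<in> ball 0 R"
  obtains r M where "norm x < r" "r < R" "summable M"
    "\<And>a w k. norm a \<le> A \<Longrightarrow> norm w \<le> r \<Longrightarrow> norm (outer_term q a c w k) \<le> M k"
proof -
  obtain r \<rho> where r: "norm x < r" "1 < r" "r < \<rho>" "\<rho> < R"
    using radius_between[OF assms] .
  obtain K where K: "K \<ge> 0"
    "\<And>a w k. norm a \<le> A \<Longrightarrow> norm (outer_term q a c w k) \<le> K * (norm w / \<rho>) ^ k"
    using outer_term_bound[of \<rho> A] r by force
  show ?thesis
  proof (rule that[of r "\<lambda>k. K * (r / \<rho>) ^ k"])
    show "summable (\<lambda>k. K * (r / \<rho>) ^ k)"
      using r by (intro summable_mult summable_geometric) auto
    fix a w :: complex and k :: nat
    assume "norm a \<le> A" "norm w \<le> r"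
    then show "norm (outer_term q a c w k) \<le> K * (r / \<rho>) ^ k"
      using r K(1) by (intro order_trans[OF K(2)] mult_left_mono power_mono divide_right_mono) auto
  qed (use r in auto)
qed

section \<open>Convergence and holomorphy of the series\<close>

lemma outer_series_locally_uniform:
  "locally_uniform_limit (ball 0 R)
     (\<lambda>N x. \<Sum>k<N. outer_term q a c x k) (\<lambda>x. \<Sum>k. outer_term q a c x k)"
  unfolding locally_uniform_limit_def
proof
  fix x :: complex assume "x \<in> ball 0 R"
  then obtain r M where r: "norm x < r" "r < R" "summable M"
    and M: "\<And>w k. norm w \<le> r \<Longrightarrow> norm (outer_term q a c w k) \<le> M k"
    using outer_term_majorant[of _ "norm a"] order_refl by metis
  show "\<exists>U. open U \<and> x \<in> U \<and> uniform_limit (U \<inter> ball 0 R)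
      (\<lambda>N x. \<Sum>k<N. outer_term q a c x k) (\<lambda>x. \<Sum>k. outer_term q a c x k) sequentially"
    using r M by (intro exI[of _ "ball 0 r"] conjI Weierstrass_m_test[where M = M]) auto
qed

lemma outer_series_holomorphic_x: "(\<lambda>x. \<Sum>k. outer_term q a c x k) holomorphic_on ball 0 R"
proof (rule holomorphic_on_suminf)
  show "(\<lambda>x. outer_term q a c x k) holomorphic_on ball 0 R" for k
    unfolding outer_term_def by (intro holomorphic_intros)
  fix z :: complex assume "z \<in> ball 0 R"
  then obtain r M where r: "norm z < r" "r < R" "summable M"
    and M: "\<And>w k. norm w \<le> r \<Longrightarrow> norm (outer_term q a c w k) \<le> M k"
    using outer_term_majorant[of _ "norm a"] order_refl by metis
  have "norm w \<le> r" if "w \<in> cball z (r - norm z)" for w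
    using norm_cball_add[OF that] by simp
  then show "\<exists>d>0. cball z d \<subseteq> ball 0 R \<and>
      (\<exists>M. summable M \<and> (\<forall>k. \<forall>w\<in>cball z d. norm (outer_term q a c w k) \<le> M k))"
    using r M by (intro exI[of _ "r - norm z"] conjI exI[of _ M]) force+
qed auto

lemma inner_series_holomorphic_a: "(\<lambda>a. \<Sum>n. inner_term q a c k n) holomorphic_on UNIV"
proof (rule holomorphic_on_suminf)
  show "(\<lambda>a. inner_term q a c k n) holomorphic_on UNIV" for n
    unfolding inner_term_def qpoch_def
    by (intro holomorphic_intros) (use qpoch_q_nonzero[of n] in \<open>simp add: qpoch_def\<close>)
  fix z :: complex
  obtain \<rho> where \<rho>: "1 < \<rho>" "\<rho> < R"
    using dense[OF R_gt_1] by blast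
  then obtain K where K: "\<And>a k n. norm a \<le> norm z + 1 \<Longrightarrow>
      norm (inner_term q a c k n) \<le> K * (1 / \<rho>) ^ k * (1 / \<rho>) ^ n"
    using inner_term_bound[of \<rho> "norm z + 1"] by force
  have "norm (inner_term q a c k n) \<le> K * (1 / \<rho>) ^ k * (1 / \<rho>) ^ n" if "a \<in> cball z 1" for a n
    using norm_cball_add[OF that] by (intro K) auto
  moreover have "summable (\<lambda>n. K * (1 / \<rho>) ^ k * (1 / \<rho>) ^ n)"
    by (intro summable_mult summable_inverse_power \<rho>)
  ultimately show "\<exists>d>0. cball z d \<subseteq> UNIV \<and>
      (\<exists>M. summable M \<and> (\<forall>n. \<forall>w\<in>cball z d. norm (inner_term q w c k n) \<le> M n))"
    by (intro exI[of _ 1] conjI exI[of _ "\<lambda>n. K * (1 / \<rho>) ^ k * (1 / \<rho>) ^ n"]) auto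
qed auto

lemma outer_series_holomorphic_a:
  assumes "x \<in> ball 0 R"
  shows "(\<lambda>a. \<Sum>k. outer_term q a c x k) holomorphic_on UNIV"
proof (rule holomorphic_on_suminf)
  show "(\<lambda>a. outer_term q a c x k) holomorphic_on UNIV" for k
    unfolding outer_term_def by (intro holomorphic_intros inner_series_holomorphic_a)
  fix z :: complex
  obtain r M where r: "norm x < r" "summable M"
    and M: "\<And>a w k. norm a \<le> norm z + 1 \<Longrightarrow> norm w \<le> r \<Longrightarrow> norm (outer_term q a c w k) \<le> M k"
    using outer_term_majorant[OF assms, of "norm z + 1"] by metis
  have "norm (outer_term q a c x k) \<le> M k" if "a \<in> cball z 1" for a k
    using norm_cball_add[OF that] r by (intro M) auto
  then show "\<exists>d>0. cball z d \<subseteq> UNIV \<and>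
      (\<exists>M. summable M \<and> (\<forall>k. \<forall>a\<in>cball z d. norm (outer_term q a c x k) \<le> M k))"
    using r by (intro exI[of _ 1] conjI exI[of _ M]) auto
qed auto

section \<open>Expansion of the Jackson integral\<close>

lemma isCont_f_0: "isCont f 0"
  using holomorphic_on_imp_continuous_on[OF f_holomorphic] R_gt_1
  by (simp add: continuous_on_eq_continuous_at)

text \<open>
  Integration may be carried out term by term: all nodes have modulus at most
  \<open>max 1 (norm x)\<close>, which is below a radius
  \<open>r\<close> that is itself below the rate \<open>\<rho>\<close> of decay of the coefficients; so the double series over
  nodes and powers is dominated by a product of two geometric series.
\<close>
lemma jackson_integral_sums:
  assumes x: "x \<in> ball 0 R"
  shows "(\<lambda>m. c m * moment a x m) sums jackson_integral q x 1 (J_integrand q a f x)"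
proof -
  obtain r \<rho> where r: "norm x < r" "1 < r" "r < \<rho>" "\<rho> < R"
    using radius_between[OF x] .
  obtain M where M: "0 \<le> M" "\<And>n. norm (c n) \<le> M * (1 / \<rho>) ^ n"
    using coeff_decay[of \<rho>] r by auto
  define T where "T m n = jackson_term q x 1 (J_integrand q a (\<lambda>t. t ^ m) x) n" for m n
  have node: "norm (v * q ^ n) \<le> norm v" for v n
    using norm_q mult_left_mono[of "norm q ^ n" 1 "norm v"]
    by (simp add: norm_mult norm_power power_le_one)
  have "\<exists>C. \<forall>n. norm (beta_weight a x (v * q ^ n)) \<le> C" for v
  proof -
    have "Bseq (\<lambda>n. beta_weight a x (v * q ^ n))"
      using beta_weight_tendsto_1 by (intro convergent_imp_Bseq) (auto simp: convergent_def)
    then show ?thesis unfolding Bseq_def by blast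
  qed
  then obtain C where C: "\<And>v n. norm (beta_weight a x (v * q ^ n)) \<le> C v"
    by metis
  have C_nonneg: "0 \<le> C v" for v
    using order_trans[OF norm_ge_zero C] .
  have T_bound: "norm (T m n) \<le> (C 1 + norm x * C x) * norm q ^ n * r ^ m" for m n
  proof -
    have pow: "norm ((v * q ^ n) ^ m) \<le> r ^ m" if "norm v \<le> r" for v
      unfolding norm_power using order_trans[OF node that] by (intro power_mono) auto
    have "norm (T m n) \<le>
        norm (q ^ n * (beta_weight a x (1 * q ^ n) * (1 * q ^ n) ^ m))
        + norm (x * q ^ n * (beta_weight a x (x * q ^ n) * (x * q ^ n) ^ m))"
      unfolding T_def jackson_term_def J_integrand_eq
      by (rule order_trans[OF norm_triangle_ineq4]) simp
    also have "\<dots> \<le> norm q ^ n * (C 1 * r ^ m) + norm x * norm q ^ n * (C x * r ^ m)"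
      unfolding norm_mult[of "q ^ n"] norm_mult[of "x * q ^ n"] norm_mult[of x]
        norm_mult[of "beta_weight _ _ _"] norm_power[of q]
      by (intro add_mono mult_left_mono mult_mono C pow C_nonneg mult_nonneg_nonneg) (use r in auto)
    finally show ?thesis by (simp add: algebra_simps)
  qed
  have "norm (c m * T m n) \<le> ((C 1 + norm x * C x) * norm q ^ n) * (M * (r / \<rho>) ^ m)" for n m
  proof -
    have "norm (c m * T m n) \<le>
        (M * (1 / \<rho>) ^ m) * ((C 1 + norm x * C x) * norm q ^ n * r ^ m)"
      unfolding norm_mult[of "c m"] using r M(1) by (intro mult_mono M T_bound) auto
    then show ?thesis by (simp add: power_divide mult_ac)
  qed
  then have "(\<lambda>m. \<Sum>n. c m * T m n) sums (\<Sum>n. \<Sum>m. c m * T m n)"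
    using norm_q r M(1)
    by (intro suminf_swap_of_product_bound[where A = "\<lambda>n. (C 1 + norm x * C x) * norm q ^ n"
          and B = "\<lambda>m. M * (r / \<rho>) ^ m"] summable_mult summable_geometric) auto
  moreover have "(\<Sum>n. c m * T m n) = c m * moment a x m" for m
    unfolding T_def moment_def jackson_integral_def
    by (intro suminf_mult summable_J_integrand continuous_intros)
  moreover have "(\<Sum>m. c m * T m n) = jackson_term q x 1 (J_integrand q a f x) n" for n
  proof -
    have "(\<lambda>m. c m * (v * q ^ n) ^ m) sums f (v * q ^ n)" if "norm v < R" for v
      using that node[of v n] by (intro f_sums) auto
    then have "(\<lambda>m. 1 * q ^ n * (beta_weight a x (1 * q ^ n) * (c m * (1 * q ^ n) ^ m))
        - x * q ^ n * (beta_weight a x (x * q ^ n) * (c m * (x * q ^ n) ^ m))) sums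
        jackson_term q x 1 (J_integrand q a f x) n"
      unfolding jackson_term_def J_integrand_eq
      using R_gt_1 x by (intro sums_diff sums_mult) (simp_all only: norm_one mem_ball_0)
    moreover have "c m * T m n = 1 * q ^ n * (beta_weight a x (1 * q ^ n) * (c m * (1 * q ^ n) ^ m))
        - x * q ^ n * (beta_weight a x (x * q ^ n) * (c m * (x * q ^ n) ^ m))" for m
      unfolding T_def jackson_term_def J_integrand_eq by (simp add: algebra_simps)
    ultimately show ?thesis
      by (simp only: sums_iff)
  qed
  ultimately show ?thesis
    by (simp add: jackson_integral_def)
qed

text \<open>
  Collecting the powers of \<open>x\<close> exchanges a triangular double sum. A bound in product form is
  obtained from \<open>1 \<le> r ^ (m - k)\<close> for \<open>k \<le> m\<close>, where \<open>max 1 (norm x) < r < \<rho>\<close>: it converts part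
  of the decay in \<open>m\<close> into decay in \<open>k\<close>.
\<close>
lemma moment_poly_series_sums:
  assumes x: "x \<in> ball 0 R"
  shows "(\<lambda>m. c m * poly (moment_poly a m) x) sums (\<Sum>k. outer_term q a c x k)"
proof -
  obtain r \<rho> where r: "norm x < r" "1 < r" "r < \<rho>" "\<rho> < R"
    using radius_between[OF x] .
  obtain M where M: "0 \<le> M" "\<And>n. norm (c n) \<le> M * (1 / \<rho>) ^ n"
    using coeff_decay[of \<rho>] r by auto
  obtain K where K: "\<And>k n. norm (moment_coeff a k n) \<le> K"
    using moment_coeff_bounded[of "norm a"] by force
  have "0 \<le> K"
    using order_trans[OF norm_ge_zero K] .
  \<comment> \<open>The triangle is completed by zeros, so that column \<open>k\<close> is an inner series shifted by \<open>k\<close>.\<close>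
  define T where "T m k = (if k \<le> m then c m * (moment_coeff a k (m - k) * x ^ k) else 0)" for m k
  have "norm (T m k) \<le> (M * K * (r / \<rho>) ^ m) * (norm x / r) ^ k" for m k
  proof (cases "k \<le> m")
    case True
    have "norm (T m k) \<le> (M * (1 / \<rho>) ^ m) * (K * norm x ^ k)"
    proof -
      have "norm (c m) * (norm (moment_coeff a k (m - k)) * norm x ^ k) \<le>
          (M * (1 / \<rho>) ^ m) * (K * norm x ^ k)"
        using r M(1) \<open>0 \<le> K\<close> by (intro mult_mono M K mult_nonneg_nonneg) auto
      then show ?thesis
        using True by (simp add: T_def norm_mult norm_power)
    qed
    also have "\<dots> \<le> (M * (1 / \<rho>) ^ m) * (K * norm x ^ k) * r ^ (m - k)"
    proof -
      have "1 \<le> r ^ (m - k)"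
        using r by (intro one_le_power) simp
      moreover have "0 \<le> (M * (1 / \<rho>) ^ m) * (K * norm x ^ k)"
        using r M(1) \<open>0 \<le> K\<close> by simp
      ultimately show ?thesis
        using mult_left_mono[of 1 "r ^ (m - k)"] by fastforce
    qed
    also have "\<dots> = (M * K * (r / \<rho>) ^ m) * (norm x / r) ^ k"
      using r True by (simp add: power_divide power_diff field_simps)
    finally show ?thesis .
  next
    case False
    then show ?thesis
      using r M(1) \<open>0 \<le> K\<close> by (simp add: T_def)
  qed
  then have "norm (T m k) \<le> (M * K * (norm x / r) ^ k) * (r / \<rho>) ^ m" for m k
    by (simp only: mult_ac)
  then have "(\<lambda>m. \<Sum>k. T m k) sums (\<Sum>k. \<Sum>m. T m k)"
    using r by (intro suminf_swap_of_product_bound[where A = "\<lambda>k. M * K * (norm x / r) ^ k"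
          and B = "\<lambda>m. (r / \<rho>) ^ m"] summable_mult summable_geometric) auto
  moreover have "(\<Sum>k. T m k) = c m * poly (moment_poly a m) x" for m
  proof -
    have "(\<Sum>k. T m k) = (\<Sum>k\<le>m. T m k)"
      by (intro suminf_finite) (auto simp: T_def)
    also have "\<dots> = c m * poly (moment_poly a m) x"
      by (simp add: T_def poly_moment_poly sum_distrib_left)
    finally show ?thesis .
  qed
  moreover have "(\<Sum>m. T m k) = outer_term q a c x k" for k
  proof -
    have "(\<lambda>n. x ^ k * inner_term q a c k n) sums outer_term q a c x k"
      unfolding outer_term_def by (intro sums_mult summable_sums summable_inner_term)
    also have "(\<lambda>n. x ^ k * inner_term q a c k n) = (\<lambda>n. T (n + k) k)"
      by (simp add: T_def inner_term_eq mult_ac)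
    finally have "(\<lambda>m. T m k) sums outer_term q a c x k"
      by (subst (asm) sums_zero_iff_shift) (auto simp: T_def)
    then show ?thesis
      by (simp add: sums_iff)
  qed
  ultimately show ?thesis
    by simp
qed

text \<open>
  After termwise integration the zeroth moment factors out of the series, and its value cancels
  the factors \<open>(a/x;q)\<^sub>\<infinity>\<close> and \<open>(q/x;q)\<^sub>\<infinity>\<close> in front of the integral, which are the ones that are
  singular in \<open>x\<close>.
\<close>
lemma J_eq_J_series:
  assumes a: "qpoch_inf a q \<noteq> 0" and x: "x \<in> J_domain q a R"
  shows "J q a f x = J_series q a c x"
proof -
  have "x \<in> ball 0 R" "x \<noteq> 0" and qx: "qpoch_inf (q / x) q \<noteq> 0"
    and "\<forall>n. qpoch_inf (a * q ^ n / x) q \<noteq> 0"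
    using x by (auto simp: J_domain_def)
  from this(4) have ax: "qpoch_inf (a / x) q \<noteq> 0"
    by (drule_tac spec[of _ 0]) simp
  define S where "S = (\<Sum>k. outer_term q a c x k)"
  have "(\<lambda>m. moment a x 0 * (c m * poly (moment_poly a m) x)) sums (moment a x 0 * S)"
    unfolding S_def by (intro sums_mult moment_poly_series_sums \<open>x \<in> ball 0 R\<close>)
  moreover have "c m * moment a x m = moment a x 0 * (c m * poly (moment_poly a m) x)" for m
    by (subst moment_eq[OF \<open>x \<noteq> 0\<close> a ax]) (rule mult.left_commute)
  ultimately have "(\<lambda>m. c m * moment a x m) sums (moment a x 0 * S)"
    by (simp only:)
  then have integral: "jackson_integral q x 1 (J_integrand q a f x) = moment a x 0 * S"
    using jackson_integral_sums[OF \<open>x \<in> ball 0 R\<close>] sums_unique2 by blast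
  have "J q a f x = qpoch_inf a q * qpoch_inf (a / x) q * moment a x 0
      / (qpoch_inf a q * qpoch_inf (q / x) q) * S"
    unfolding J_def integral using a by simp
  also have "\<dots> = qpoch_inf q q * qpoch_inf x q / qpoch_inf a q * S"
    unfolding moment_0_eq[OF \<open>x \<noteq> 0\<close> qx a ax] using qx by simp
  finally show ?thesis
    by (simp add: J_series_def S_def)
qed

section \<open>Holomorphic and meromorphic continuation\<close>

lemma J_series_holomorphic_x: "(\<lambda>x. J_series q a c x) holomorphic_on ball 0 R"
  unfolding J_series_def divide_inverse
  by (intro holomorphic_intros outer_series_holomorphic_x
      holomorphic_on_subset[OF qpoch_inf_holomorphic]) auto

lemma J_series_quotient:
  "J_series q a c x =
    (qpoch_inf q q * qpoch_inf x q * (\<Sum>k. outer_term q a c x k)) / qpoch_inf a q"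
  by (simp add: J_series_def)

lemma J_series_meromorphic_a:
  assumes "x \<in> ball 0 R"
  shows "(\<lambda>a. J_series q a c x) meromorphic_on UNIV"
  unfolding J_series_quotient
  by (intro meromorphic_intros analytic_on_imp_meromorphic_on)
     (simp_all add: analytic_on_open qpoch_inf_holomorphic outer_series_holomorphic_a[OF assms])

lemma J_series_holomorphic_a:
  assumes "x \<in> ball 0 R"
  shows "(\<lambda>a. J_series q a c x) holomorphic_on (UNIV - {1 / q ^ j | j :: nat. True})"
  unfolding J_series_quotient
proof (intro holomorphic_intros holomorphic_on_subset[OF qpoch_inf_holomorphic]
    holomorphic_on_subset[OF outer_series_holomorphic_a[OF assms]])
  fix a assume a: "a \<in> UNIV - {1 / q ^ j | j :: nat. True}"
  show "qpoch_inf a q \<noteq> 0"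
  proof
    assume "qpoch_inf a q = 0"
    then obtain j where j: "a * q ^ j = 1"
      by (auto simp: qpoch_inf_eq_0_iff)
    then have "q ^ j \<noteq> 0"
      by (metis mult_zero_right zero_neq_one)
    with j have "a = 1 / q ^ j"
      by (simp add: eq_divide_eq)
    with a show False by blast
  qed
qed auto

end

theorem theorem2p2:
  fixes q :: complex and R :: real and f :: "complex \<Rightarrow> complex" and c :: "nat \<Rightarrow> complex"
  assumes "0 < norm q" and "norm q < 1"
    and "R > 1"
    and "f holomorphic_on ball 0 R"
    and "\<And>z. z \<in> ball 0 R \<Longrightarrow> (\<lambda>n. c n * z ^ n) sums f z"
  shows "(\<forall>a. qpoch_inf a q \<noteq> 0 \<longrightarrow>
            (\<forall>x\<in>J_domain q a R. summable (jackson_term q x 1 (J_integrand q a f x))) \<and>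
            (\<forall>k. summable (inner_term q a c k)) \<and>
            locally_uniform_limit (ball 0 R)
              (\<lambda>N x. \<Sum>k<N. outer_term q a c x k) (\<lambda>x. \<Sum>k. outer_term q a c x k) \<and>
            (\<exists>F. F holomorphic_on ball 0 R \<and>
                 (\<forall>x\<in>J_domain q a R. F x = J q a f x) \<and>
                 (\<forall>x\<in>ball 0 R. F x = J_series q a c x))) \<and>
         (\<forall>x\<in>ball 0 R.
            (\<lambda>a. J_series q a c x) meromorphic_on UNIV \<and>
            (\<lambda>a. J_series q a c x) holomorphic_on (UNIV - {1 / q ^ j | j :: nat. True}) \<and>
            (\<forall>a. qpoch_inf a q \<noteq> 0 \<and> x \<in> J_domain q a R \<longrightarrow> J_series q a c x = J q a f x))"
proof -
  interpret q_disc_power_series q R f c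
    using assms by unfold_locales auto
  show ?thesis
  proof (intro conjI allI impI ballI)
    fix a
    show "\<exists>F. F holomorphic_on ball 0 R \<and> (\<forall>x\<in>J_domain q a R. F x = J q a f x) \<and>
        (\<forall>x\<in>ball 0 R. F x = J_series q a c x)" if "qpoch_inf a q \<noteq> 0"
      using J_series_holomorphic_x J_eq_J_series[OF that]
      by (intro exI[of _ "J_series q a c"]) auto
  qed (use J_eq_J_series isCont_f_0 in \<open>auto intro: summable_J_integrand summable_inner_term
         outer_series_locally_uniform J_series_meromorphic_a J_series_holomorphic_a[simplified]\<close>)
qed

end
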